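(* Let $I\subset[0,\infty)$ be an interval with interior $I^{\circ}$, and let $f:I\to\mathbb{R}$ be twice differentiable on $I^{\circ}$ with $f''\in L[a,b]$, where $a,b\in I^{\circ}$ and $a<b$. Suppose that $|f''|^{q}$ is $s$-convex (in the second sense) on $[a,b]$ for some fixed $s\in(0,1]$ and some $q\ge 1$. Then for all $x\in[a,b]$, $\lambda\in[0,1]$ and $\alpha>0$, $$\left|I_f(x,\lambda,\alpha,a,b)\right|\le C_1(\alpha,\lambda)^{1-\frac1q}\left\{\frac{(x-a)^{\alpha+2}}{(\alpha+1)(b-a)}\Big(|f''(x)|^{q}C_2(\alpha,\lambda,s)+|f''(a)|^{q}C_3(\alpha,\lambda,s)\Big)^{\frac1q}+\frac{(b-x)^{\alpha+2}}{(\alpha+1)(b-a)}\Big(|f''(x)|^{q}C_2(\alpha,\lambda,s)+|f''(b)|^{q}C_3(\alpha,\lambda,s)\Big)^{\frac1q}\right\},$$ where $$C_1(\alpha,\lambda)=\begin{cases}\dfrac{\alpha[(\alpha+1)\lambda]^{1+\frac2\alpha}}{\alpha+2}-\dfrac{(\alpha+1)\lambda}{2}+\dfrac1{\alpha+2}, & 0\le\lambda\le\frac1{\alpha+1},\\[2mm] \dfrac{(\alpha+1)\lambda}{2}-\dfrac1{\alpha+2}, & \frac1{\alpha+1}<\lambda\le1,\end{cases}$$ $$C_2(\alpha,\lambda,s)=\begin{cases}\dfrac{2\alpha[(\alpha+1)\lambda]^{\frac{\alpha+s+2}{\alpha}}}{(s+2)(\alpha+s+2)}-\dfrac{(\alpha+1)\lambda}{s+2}+\dfrac1{\alpha+s+2},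 & 0\le\lambda\le\frac1{\alpha+1},\\[2mm] \dfrac{(\alpha+1)\lambda}{s+2}-\dfrac1{\alpha+s+2}, & \frac1{\alpha+1}<\lambda\le1,\end{cases}$$ and, for $0\le\lambda\le\frac1{\alpha+1}$, $$C_3(\alpha,\lambda,s)=\beta(\alpha+2,s+1)-(\alpha+1)\lambda\,\beta(2,s+1)+2(\alpha+1)\lambda\,\beta\big([(\alpha+1)\lambda]^{\frac1\alpha};2,s+1\big)-2\beta\big([(\alpha+1)\lambda]^{\frac1\alpha};\alpha+2,s+1\big),$$ while for $\frac1{\alpha+1}<\lambda\le1$, $$C_3(\alpha,\lambda,s)=(\alpha+1)\lambda\,\beta(2,s+1)-\beta(\alpha+2,s+1).$$
   Context: A function $g$ is $s$-convex in the second sense on $[a,b]\subset[0,\infty)$, with $s\in(0,1]$, if $g(\mu u+\nu v)\le\mu^{s}g(u)+\nu^{s}g(v)$ for all $u,v\in[a,b]$ and $\mu,\nu\ge0$ with $\mu+\nu=1$. For $x\in[a,b]$, $\lambda\in[0,1]$, $\alpha>0$, define $$I_f(x,\lambda,\alpha,a,b)=(1-\lambda)\left[\frac{(x-a)^{\alpha}+(b-x)^{\alpha}}{b-a}\right]f(x)+\lambda\left[\frac{(x-a)^{\alpha}f(a)+(b-x)^{\alpha}f(b)}{b-a}\right]+\left(\frac1{\alpha+1}-\lambda\right)\left[\frac{(b-x)^{\alpha+1}-(x-a)^{\alpha+1}}{b-a}\right]f'(x)-\frac{\Gamma(\alpha+1)}{b-a}\left[J^{\alpha}_{x^-}f(a)+J^{\alpha}_{x^+}f(b)\right],$$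 where $\Gamma$ is the Gamma function and the Riemann–Liouville fractional integrals are $$J^{\alpha}_{x^-}f(a)=\frac1{\Gamma(\alpha)}\int_a^x(t-a)^{\alpha-1}f(t)\,dt,\qquad J^{\alpha}_{x^+}f(b)=\frac1{\Gamma(\alpha)}\int_x^b(b-t)^{\alpha-1}f(t)\,dt$$ (equal to $0$ when $x=a$, respectively $x=b$). Beta function: $\beta(u,v)=\int_0^1t^{u-1}(1-t)^{v-1}dt$ for $u,v>0$. Incomplete Beta function: $\beta(c;u,v)=\int_0^{c}t^{u-1}(1-t)^{v-1}dt$ for $0\le c\le1$, $u,v>0$. *)

theory Defs
  imports "HOL-Analysis.Analysis"
begin

text \<open>In the second sense: the weights sum to \<open>1\<close> before being raised to the power \<open>s\<close>.\<close>

definition s_convex_on :: "real \<Rightarrow> real set \<Rightarrow> (real \<Rightarrow> real) \<Rightarrow> bool" where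
  "s_convex_on s S g \<longleftrightarrow> 0 < s \<and> s \<le> 1 \<and> S \<subseteq> {0..} \<and>
     (\<forall>u\<in>S. \<forall>v\<in>S. \<forall>\<mu>\<ge>0. \<forall>\<nu>\<ge>0. \<mu> + \<nu> = 1 \<longrightarrow>
        g (\<mu> * u + \<nu> * v) \<le> \<mu> powr s * g u + \<nu> powr s * g v)"

text \<open>
  Riemann--Liouville fractional integrals: \<open>RL_minus \<alpha> x f y\<close> is $J^\alpha_{x^-} f(y)$ for
  \<open>y \<le> x\<close>, and \<open>RL_plus \<alpha> x f y\<close> is $J^\alpha_{x^+} f(y)$ for \<open>x \<le> y\<close>.
  Since \<open>0 powr p = 0\<close> for every \<open>p\<close>, the integrands are \<open>0\<close> at \<open>t = y\<close>, even where
  the kernel is singular; a single point does not affect the integral.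
\<close>

definition RL_minus :: "real \<Rightarrow> real \<Rightarrow> (real \<Rightarrow> real) \<Rightarrow> real \<Rightarrow> real" where
  "RL_minus \<alpha> x f y = 1 / Gamma \<alpha> * (LINT t:{y..x}|lebesgue. (t - y) powr (\<alpha> - 1) * f t)"

definition RL_plus :: "real \<Rightarrow> real \<Rightarrow> (real \<Rightarrow> real) \<Rightarrow> real \<Rightarrow> real" where
  "RL_plus \<alpha> x f y = 1 / Gamma \<alpha> * (LINT t:{x..y}|lebesgue. (y - t) powr (\<alpha> - 1) * f t)"

definition inc_Beta :: "real \<Rightarrow> real \<Rightarrow> real \<Rightarrow> real" where
  "inc_Beta c u v = (LINT t:{0..c}|lebesgue. t powr (u - 1) * (1 - t) powr (v - 1))"

text \<open>
  The library function \<open>Beta\<close> is defined through \<open>Gamma\<close>; for positive arguments it is the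
  Euler integral.
\<close>

lemma inc_Beta_1:
  assumes "u > 0" "v > 0"
  shows "inc_Beta 1 u v = Beta u v"
proof -
  have *: "((\<lambda>t. t powr (u - 1) * (1 - t) powr (v - 1)) has_integral Beta u v) {0..1}"
    using has_integral_Beta_real[OF assms] by simp
  then have "(\<lambda>t. t powr (u - 1) * (1 - t) powr (v - 1)) absolutely_integrable_on {0..1}"
    by (intro nonnegative_absolutely_integrable_1) (auto simp: integrable_on_def)
  then show ?thesis
    unfolding inc_Beta_def using set_lebesgue_integral_eq_integral(2) * integral_unique by metis
qed

definition I_frac ::
  "(real \<Rightarrow> real) \<Rightarrow> real \<Rightarrow> real \<Rightarrow> real \<Rightarrow> real \<Rightarrow> real \<Rightarrow> real" where
  "I_frac f x lam \<alpha> a b =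
     (1 - lam) * (((x - a) powr \<alpha> + (b - x) powr \<alpha>) / (b - a)) * f x
     + lam * (((x - a) powr \<alpha> * f a + (b - x) powr \<alpha> * f b) / (b - a))
     + (1 / (\<alpha> + 1) - lam) * (((b - x) powr (\<alpha> + 1) - (x - a) powr (\<alpha> + 1)) / (b - a)) * deriv f x
     - Gamma (\<alpha> + 1) / (b - a) * (RL_minus \<alpha> x f a + RL_plus \<alpha> x f b)"

definition C1 :: "real \<Rightarrow> real \<Rightarrow> real" where
  "C1 \<alpha> lam =
     (if lam \<le> 1 / (\<alpha> + 1)
      then \<alpha> * ((\<alpha> + 1) * lam) powr (1 + 2 / \<alpha>) / (\<alpha> + 2) - (\<alpha> + 1) * lam / 2 + 1 / (\<alpha> + 2)
      else (\<alpha> + 1) * lam / 2 - 1 / (\<alpha> + 2))"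

definition C2 :: "real \<Rightarrow> real \<Rightarrow> real \<Rightarrow> real" where
  "C2 \<alpha> lam s =
     (if lam \<le> 1 / (\<alpha> + 1)
      then 2 * \<alpha> * ((\<alpha> + 1) * lam) powr ((\<alpha> + s + 2) / \<alpha>) / ((s + 2) * (\<alpha> + s + 2))
           - (\<alpha> + 1) * lam / (s + 2) + 1 / (\<alpha> + s + 2)
      else (\<alpha> + 1) * lam / (s + 2) - 1 / (\<alpha> + s + 2))"

definition C3 :: "real \<Rightarrow> real \<Rightarrow> real \<Rightarrow> real" where
  "C3 \<alpha> lam s =
     (if lam \<le> 1 / (\<alpha> + 1)
      then Beta (\<alpha> + 2) (s + 1) - (\<alpha> + 1) * lam * Beta 2 (s + 1)
           + 2 * (\<alpha> + 1) * lam * inc_Beta (((\<alpha> + 1) * lam) powr (1 / \<alpha>)) 2 (s + 1)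
           - 2 * inc_Beta (((\<alpha> + 1) * lam) powr (1 / \<alpha>)) (\<alpha> + 2) (s + 1)
      else (\<alpha> + 1) * lam * Beta 2 (s + 1) - Beta (\<alpha> + 2) (s + 1))"

end

theory Submission
  imports Defs
begin

text \<open>
  With \<open>p = a\<close> or \<open>p = b\<close> and \<open>h = x - p\<close>, integrating
  \<open>t * ((\<alpha> + 1) * lam - t powr \<alpha>) * f'' (p + t * h)\<close> twice by parts over \<open>{0..1}\<close> gives the part of
  \<open>I_frac\<close> attached to \<open>p\<close>, up to a power of \<open>h\<close>. Each part is then bounded by the power mean
  inequality and s-convexity; \<open>C1\<close>, \<open>C2\<close>, \<open>C3\<close> are the integrals of the absolute value of the
  kernel against \<open>1\<close>, \<open>t powr s\<close> and \<open>(1 - t) powr s\<close>. The power mean inequality is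
  obtained by integrating a tangent line inequality for \<open>y powr q\<close>, so that
  the integrability of \<open>\<bar>f''\<bar> powr q\<close> never enters.
\<close>

section \<open>The power mean inequality\<close>

text \<open>Young's inequality for \<open>y powr q\<close> and \<open>1\<close> with weights
  \<open>1 / q\<close> and \<open>1 - 1 / q\<close>. The right-hand side is to be used after
  rescaling \<open>y\<close>, which moves the point of tangency from \<open>1\<close> to any
  \<open>M > 0\<close>.\<close>

lemma powr_le_tangent:
  fixes y q :: real
  assumes "q \<ge> 1" "y \<ge> 0"
  shows "y \<le> y powr q / q + (1 - 1 / q)"
proof (cases "y = 0")
  case False
  have "(y powr q) powr (1 / q) * 1 powr (1 - 1 / q) \<le> 1 / q * y powr q + (1 - 1 / q) * 1"
    by (rule Youngs_inequality_0) (use assms False in auto)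
  then show ?thesis
    using assms False by (simp add: powr_powr)
qed (use assms in auto)

text \<open>The tangent inequality at a free parameter \<open>M > 0\<close>, multiplied by the
  weight \<open>k\<close> and integrated, bounds \<open>K\<close> by an expression in
  \<open>B\<close>, \<open>C\<close> and \<open>M\<close>; minimizing over \<open>M\<close> gives
  the power mean form. The function \<open>v\<close> stands for an integrable majorant of
  \<open>k * y powr q\<close>, so that s-convexity can be inserted pointwise.\<close>

lemma has_integral_power_mean_bound:
  fixes k u v y :: "real \<Rightarrow> real"
  assumes q: "q \<ge> 1" and C: "C > 0"
    and k: "(k has_integral C) S" and v: "(v has_integral B) S" and u: "(u has_integral K) S"
    and nonneg: "\<And>t. t \<in> S \<Longrightarrow> 0 \<le> k t" "\<And>t. t \<in> S \<Longrightarrow> 0 \<le> y t"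
    and uk: "\<And>t. t \<in> S \<Longrightarrow> \<bar>u t\<bar> \<le> k t * y t"
    and kv: "\<And>t. t \<in> S \<Longrightarrow> k t * y t powr q \<le> v t"
  shows "\<bar>K\<bar> \<le> C powr (1 - 1 / q) * B powr (1 / q)"
proof -
  have B: "B \<ge> 0"
    using v by (rule has_integral_nonneg) (use kv nonneg in \<open>force intro: order_trans[rotated]\<close>)
  have rhs: "((\<lambda>t. M powr (1 - q) / q * v t + M * (1 - 1 / q) * k t)
      has_integral M powr (1 - q) / q * B + M * (1 - 1 / q) * C) S" for M
    by (intro has_integral_add has_integral_mult_right k v)
  have bound: "\<bar>K\<bar> \<le> M powr (1 - q) / q * B + M * (1 - 1 / q) * C" if M: "M > 0" for M
  proof -
    have "norm (integral S u) \<le> integral S (\<lambda>t. M powr (1 - q) / q * v t + M * (1 - 1 / q) * k t)"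
    proof (rule integral_norm_bound_integral)
      show "u integrable_on S" using u by blast
      show "(\<lambda>t. M powr (1 - q) / q * v t + M * (1 - 1 / q) * k t) integrable_on S"
        using rhs by blast
      fix t assume t: "t \<in> S"
      \<comment> \<open>Multiplied by \<open>M\<close>, this is linear in \<open>y t powr q\<close>,
        with equality at \<open>y t = M\<close>.\<close>
      have "y t / M \<le> (y t / M) powr q / q + (1 - 1 / q)"
        by (rule powr_le_tangent) (use q M nonneg t in auto)
      then have "y t \<le> M * ((y t / M) powr q / q + (1 - 1 / q))"
        using M by (simp add: field_simps)
      also have "\<dots> = M powr (1 - q) / q * y t powr q + M * (1 - 1 / q)"
        using M nonneg(2)[OF t] by (simp add: powr_divide powr_diff field_simps)
      finally have "k t * y t \<le> k t * (M powr (1 - q) / q * y t powr q + M * (1 - 1 / q))"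
        using nonneg t by (intro mult_left_mono) auto
      also have "\<dots> = M powr (1 - q) / q * (k t * y t powr q) + M * (1 - 1 / q) * k t"
        by (simp add: algebra_simps)
      also have "\<dots> \<le> M powr (1 - q) / q * v t + M * (1 - 1 / q) * k t"
        using kv[OF t] q by (intro add_right_mono mult_left_mono) auto
      finally show "norm (u t) \<le> M powr (1 - q) / q * v t + M * (1 - 1 / q) * k t"
        using uk[OF t] by simp
    qed
    also have "\<dots> = M powr (1 - q) / q * B + M * (1 - 1 / q) * C"
      by (rule integral_unique[OF rhs])
    finally show ?thesis
      using u by (simp add: integral_unique)
  qed
  show ?thesis
  proof (cases "B = 0")
    case True
    \<comment> \<open>The minimizing \<open>M\<close> would be \<open>0\<close>, which is excluded;
      so \<open>M = e / C\<close> is sent to \<open>0\<close> instead.\<close>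
    have "\<bar>K\<bar> \<le> 0 + e" if "e > 0" for e
    proof -
      have "\<bar>K\<bar> \<le> (1 - 1 / q) * e"
        using bound[of "e / C"] True C that by (simp add: mult.commute)
      also have "\<dots> \<le> e"
        using q that by (simp add: mult_le_cancel_right1)
      finally show ?thesis by simp
    qed
    then have "\<bar>K\<bar> \<le> 0" by (rule field_le_epsilon)
    then show ?thesis by simp
  next
    case False
    then have B: "B > 0" using B by simp
    \<comment> \<open>the minimizer of \<open>bound\<close>\<close>
    define M where "M = (B / C) powr (1 / q)"
    have M: "M > 0" and Mq: "M powr q = B / C"
      using B C q by (auto simp: M_def powr_powr)
    have "\<bar>K\<bar> \<le> M powr (1 - q) / q * B + M * (1 - 1 / q) * C"
      by (rule bound[OF M])
    \<comment> \<open>At this \<open>M\<close> the two terms of the bound are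
      \<open>M * C / q\<close> and \<open>M * C * (1 - 1 / q)\<close>.\<close>
    also have "M powr (1 - q) * B = M * C"
      using M B C by (simp add: powr_diff Mq)
    then have "M powr (1 - q) / q * B + M * (1 - 1 / q) * C = M * C"
      using q by (simp add: field_simps)
    also have "M * C = C powr (1 - 1 / q) * B powr (1 / q)"
      using B C by (simp add: M_def powr_divide powr_diff)
    finally show ?thesis .
  qed
qed

section \<open>Integrals of the absolute kernel against the weights\<close>

text \<open>The kernel \<open>g t = t * (c - t powr \<alpha>)\<close> is nonnegative up to
  \<open>\<tau>\<close> and nonpositive from there to \<open>1\<close>, so its absolute value is
  twice the restriction of \<open>g\<close> to \<open>{0..\<tau>}\<close> minus \<open>g\<close>.
  The minimum with \<open>1\<close> covers the case in which the sign never changes on the unit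
  interval.\<close>

lemma has_integral_abs_kernel:
  fixes w :: "real \<Rightarrow> real"
  assumes \<alpha>: "\<alpha> > 0" and c: "c \<ge> 0" and \<tau>: "\<tau> = min 1 (c powr (1 / \<alpha>))"
    and P: "((\<lambda>t. t * w t) has_integral P) {0..1}"
    and Q: "((\<lambda>t. t powr (\<alpha> + 1) * w t) has_integral Q) {0..1}"
    and P': "((\<lambda>t. t * w t) has_integral P') {0..\<tau>}"
    and Q': "((\<lambda>t. t powr (\<alpha> + 1) * w t) has_integral Q') {0..\<tau>}"
  shows "((\<lambda>t. \<bar>t * (c - t powr \<alpha>)\<bar> * w t) has_integral 2 * (c * P' - Q') - (c * P - Q)) {0..1}"
proof -
  have "((\<lambda>t. c * (t * w t) - t powr (\<alpha> + 1) * w t) has_integral c * P' - Q') {0..\<tau>}"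
    by (intro has_integral_diff has_integral_mult_right P' Q')
  then have "((\<lambda>t. if t \<in> {0..\<tau>} then c * (t * w t) - t powr (\<alpha> + 1) * w t else 0)
      has_integral c * P' - Q') {0..1}"
    by (subst has_integral_restrict) (use \<tau> in auto)
  then have "((\<lambda>t. 2 * (if t \<in> {0..\<tau>} then c * (t * w t) - t powr (\<alpha> + 1) * w t else 0)
      - (c * (t * w t) - t powr (\<alpha> + 1) * w t)) has_integral 2 * (c * P' - Q') - (c * P - Q)) {0..1}"
    by (intro has_integral_diff has_integral_mult_right P Q)
  then show ?thesis
  proof (rule has_integral_eq[rotated])
    fix t :: real assume t: "t \<in> {0..1}"
    have *: "t powr (\<alpha> + 1) = t * t powr \<alpha>"
      using t by (cases "t = 0") (auto simp: powr_add)
    \<comment> \<open>Raising to the power \<alpha> is strictly increasing on nonnegative reals, and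
      the cutoff of \<open>\<tau>\<close> at \<open>1\<close> is harmless because
      \<open>t \<le> 1\<close>.\<close>
    have "t \<le> \<tau> \<longleftrightarrow> t powr \<alpha> \<le> c"
    proof -
      have "t powr \<alpha> \<le> c \<longleftrightarrow> t powr \<alpha> \<le> (c powr (1 / \<alpha>)) powr \<alpha>"
        using \<alpha> c by (simp add: powr_powr)
      also have "\<dots> \<longleftrightarrow> t \<le> c powr (1 / \<alpha>)"
        using \<alpha> t by (meson atLeastAtMost_iff less_imp_le not_le powr_ge_zero powr_less_mono2 powr_mono2)
      finally show ?thesis using t by (auto simp: \<tau>)
    qed
    then have abs_eq: "\<bar>t * (c - t powr \<alpha>)\<bar> = (if t \<in> {0..\<tau>} then 1 else -1) * (t * (c - t powr \<alpha>))"
      using t by (simp add: abs_mult)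
    then show "2 * (if t \<in> {0..\<tau>} then c * (t * w t) - t powr (\<alpha> + 1) * w t else 0)
        - (c * (t * w t) - t powr (\<alpha> + 1) * w t) = \<bar>t * (c - t powr \<alpha>)\<bar> * w t"
      unfolding * abs_eq by (simp add: algebra_simps)
  qed
qed

text \<open>The Euler integrand is nonnegative and integrable on \<open>{0..1}\<close>, hence
  absolutely integrable there and on every \<open>{0..c}\<close>; this identifies the Lebesgue
  integral defining \<open>inc_Beta\<close> with the gauge integral.\<close>

lemma has_integral_inc_Beta:
  assumes "u > 0" "v > 0" "0 \<le> c" "c \<le> 1"
  shows "((\<lambda>t. t powr (u - 1) * (1 - t) powr (v - 1)) has_integral inc_Beta c u v) {0..c}"
proof -
  have "(\<lambda>t. t powr (u - 1) * (1 - t) powr (v - 1)) absolutely_integrable_on {0..1}"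
    using has_integral_Beta_real[OF assms(1,2)]
    by (intro nonnegative_absolutely_integrable_1) (auto simp: integrable_on_def)
  then have *: "(\<lambda>t. t powr (u - 1) * (1 - t) powr (v - 1)) absolutely_integrable_on {0..c}"
    by (rule absolutely_integrable_on_subinterval) (use assms in auto)
  then have "(\<lambda>t. t powr (u - 1) * (1 - t) powr (v - 1)) integrable_on {0..c}"
    by (rule set_lebesgue_integral_eq_integral)
  then show ?thesis
    unfolding inc_Beta_def set_lebesgue_integral_eq_integral(2)[OF *] by (rule integrable_integral)
qed

lemma has_integral_C2:
  assumes \<alpha>: "\<alpha> > 0" and lam: "lam \<ge> 0" and s: "s \<ge> 0"
  shows "((\<lambda>t. \<bar>t * ((\<alpha> + 1) * lam - t powr \<alpha>)\<bar> * t powr s) has_integral C2 \<alpha> lam s) {0..1}"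
proof -
  define c where "c = (\<alpha> + 1) * lam"
  define \<tau> where "\<tau> = min 1 (c powr (1 / \<alpha>))"
  have c: "c \<ge> 0" using \<alpha> lam by (simp add: c_def)
  have \<tau>: "0 \<le> \<tau>" "\<tau> \<le> 1" by (auto simp: \<tau>_def)
  \<comment> \<open>The upper limit \<open>d\<close> is left free because the moments are taken both
    at \<open>\<tau>\<close> and at \<open>1\<close>.\<close>
  have P: "((\<lambda>t. t * t powr s) has_integral d powr (s + 2) / (s + 2)) {0..d}" if "d \<ge> 0" for d
  proof (rule has_integral_eq)
    show "((\<lambda>t. t powr (s + 1)) has_integral d powr (s + 2) / (s + 2)) {0..d}"
      using has_integral_powr_from_0[of "s + 1" d] s that by (simp add: add.assoc)
    show "t powr (s + 1) = t * t powr s" if "t \<in> {0..d}" for t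
      using that by (cases "t = 0") (auto simp: powr_add)
  qed
  have Q: "((\<lambda>t. t powr (\<alpha> + 1) * t powr s) has_integral d powr (\<alpha> + s + 2) / (\<alpha> + s + 2)) {0..d}"
    if "d \<ge> 0" for d
    using has_integral_powr_from_0[of "\<alpha> + 1 + s" d] s \<alpha> that
    by (simp add: powr_add[symmetric] add_ac)
  have int: "((\<lambda>t. \<bar>t * (c - t powr \<alpha>)\<bar> * t powr s) has_integral
      2 * (c * (\<tau> powr (s + 2) / (s + 2)) - \<tau> powr (\<alpha> + s + 2) / (\<alpha> + s + 2))
      - (c * (1 powr (s + 2) / (s + 2)) - 1 powr (\<alpha> + s + 2) / (\<alpha> + s + 2))) {0..1}"
    by (rule has_integral_abs_kernel[OF \<alpha> c \<tau>_def P Q P Q]) (use \<tau> in auto)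
  have iff: "lam \<le> 1 / (\<alpha> + 1) \<longleftrightarrow> c \<le> 1"
    using \<alpha> by (simp add: c_def field_simps)
  have "2 * (c * (\<tau> powr (s + 2) / (s + 2)) - \<tau> powr (\<alpha> + s + 2) / (\<alpha> + s + 2))
      - (c * (1 powr (s + 2) / (s + 2)) - 1 powr (\<alpha> + s + 2) / (\<alpha> + s + 2)) = C2 \<alpha> lam s"
  proof (cases "c \<le> 1")
    case True
    have \<tau>c: "\<tau> = c powr (1 / \<alpha>)"
      using powr_mono2[of "1 / \<alpha>" c 1] True \<alpha> c by (simp add: \<tau>_def)
    define R where "R = c powr ((\<alpha> + s + 2) / \<alpha>)"
    have R: "\<tau> powr (\<alpha> + s + 2) = R"
      by (simp add: \<tau>c powr_powr R_def)
    \<comment> \<open>Since \<open>\<tau> powr \<alpha> = c\<close>, both terms evaluated at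
      \<open>\<tau>\<close> involve the same power of \<open>c\<close>.\<close>
    have "c * \<tau> powr (s + 2) = R"
    proof (cases "c = 0")
      case False
      have "c * \<tau> powr (s + 2) = c powr (1 + (s + 2) / \<alpha>)"
        using False c by (simp only: powr_add[of c 1]) (simp add: \<tau>c powr_powr)
      also have "1 + (s + 2) / \<alpha> = (\<alpha> + s + 2) / \<alpha>"
        using \<alpha> by (simp add: field_simps)
      finally show ?thesis by (simp add: R_def)
    qed (simp add: R_def)
    moreover have "C2 \<alpha> lam s = 2 * \<alpha> * R / ((s + 2) * (\<alpha> + s + 2)) - c / (s + 2) + 1 / (\<alpha> + s + 2)"
      using iff True by (simp add: C2_def R_def c_def)
    moreover have "2 * (R / (s + 2) - R / (\<alpha> + s + 2)) = 2 * \<alpha> * R / ((s + 2) * (\<alpha> + s + 2))"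
      using \<alpha> s by (simp add: divide_simps) (simp add: algebra_simps)
    ultimately show ?thesis using R by simp
  next
    case False
    \<comment> \<open>The integrals over \<open>{0..\<tau>}\<close> and \<open>{0..1}\<close> then
      agree, and twice the bracket minus the bracket leaves the second branch.\<close>
    then have "\<tau> = 1"
      using ge_one_powr_ge_zero[of c "1 / \<alpha>"] \<alpha> by (simp add: \<tau>_def)
    then show ?thesis
      using False iff by (simp add: C2_def c_def)
  qed
  with int show ?thesis by (simp add: c_def)
qed

lemma C1_eq_C2:
  assumes "\<alpha> > 0"
  shows "C1 \<alpha> lam = C2 \<alpha> lam 0"
proof -
  have "1 + 2 / \<alpha> = (\<alpha> + 2) / \<alpha>"
    using assms by (simp add: field_simps)
  moreover have "2 * \<alpha> * y / (2 * (\<alpha> + 2)) = \<alpha> * y / (\<alpha> + 2)" for y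
    using assms by (simp add: field_simps)
  ultimately show ?thesis by (simp only: C1_def C2_def add_0_right add_0_left)
qed

text \<open>The case \<open>s = 0\<close> of the previous integral. Although
  \<open>0 powr 0 = 0\<close>, the weight \<open>t powr 0\<close> may be dropped also at
  \<open>t = 0\<close>, where the kernel vanishes.\<close>

lemma has_integral_C1:
  assumes "\<alpha> > 0" "lam \<ge> 0"
  shows "((\<lambda>t. \<bar>t * ((\<alpha> + 1) * lam - t powr \<alpha>)\<bar>) has_integral C1 \<alpha> lam) {0..1}"
  using has_integral_C2[of \<alpha> lam 0] assms unfolding C1_eq_C2[OF assms(1)]
  by (force intro: has_integral_eq[rotated])

text \<open>Strict positivity is what the power mean bound requires of the total weight. For
  \<open>c \<le> 1\<close> it comes from the tangent inequality at exponent
  \<open>1 + 2 / \<alpha>\<close>, which bounds the negative term \<open>c / 2\<close> by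
  \<open>X / 2 + Y\<close>.\<close>

lemma C1_pos:
  assumes \<alpha>: "\<alpha> > 0" and lam: "lam \<ge> 0"
  shows "C1 \<alpha> lam > 0"
proof -
  define c where "c = (\<alpha> + 1) * lam"
  have c: "c \<ge> 0" using \<alpha> lam by (simp add: c_def)
  have iff: "lam \<le> 1 / (\<alpha> + 1) \<longleftrightarrow> c \<le> 1"
    using \<alpha> by (simp add: c_def field_simps)
  show ?thesis
  proof (cases "c \<le> 1")
    case True
    define R where "R = c powr (1 + 2 / \<alpha>)"
    define X Y where "X = \<alpha> * R / (\<alpha> + 2)" and "Y = 1 / (\<alpha> + 2)"
    have C1: "C1 \<alpha> lam = X - c / 2 + Y"
      using iff True by (simp add: C1_def R_def c_def X_def Y_def)
    have "c \<le> R / (1 + 2 / \<alpha>) + (1 - 1 / (1 + 2 / \<alpha>))"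
      unfolding R_def by (rule powr_le_tangent) (use c \<alpha> in auto)
    also have "\<dots> = X + 2 * Y"
      using \<alpha> by (simp add: X_def Y_def divide_simps)
    finally have "C1 \<alpha> lam \<ge> X / 2"
      unfolding C1 by simp
    \<comment> \<open>The lower bound \<open>X / 2\<close> degenerates at \<open>c = 0\<close>;
      there \<open>C1\<close> is simply \<open>Y\<close>.\<close>
    moreover have "X / 2 > 0" if "c \<noteq> 0"
      using that \<alpha> c by (simp add: X_def R_def)
    moreover have "C1 \<alpha> lam > 0" if "c = 0"
      using that \<alpha> by (simp add: C1 X_def Y_def R_def)
    ultimately show ?thesis by fastforce
  next
    case False
    have "1 / (\<alpha> + 2) < 1 / 2" using \<alpha> by (simp add: field_simps)
    then show ?thesis using False iff by (simp add: C1_def c_def)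
  qed
qed

text \<open>The sign splitting with weight \<open>(1 - t) powr s\<close>: the moments up to
  \<open>\<tau>\<close> are incomplete Beta values, those up to \<open>1\<close> complete
  ones.\<close>

lemma has_integral_C3:
  assumes \<alpha>: "\<alpha> > 0" and lam: "lam \<ge> 0" and s: "s \<ge> 0"
  shows "((\<lambda>t. \<bar>t * ((\<alpha> + 1) * lam - t powr \<alpha>)\<bar> * (1 - t) powr s) has_integral C3 \<alpha> lam s) {0..1}"
proof -
  define c where "c = (\<alpha> + 1) * lam"
  define \<tau> where "\<tau> = min 1 (c powr (1 / \<alpha>))"
  have c: "c \<ge> 0" using \<alpha> lam by (simp add: c_def)
  have \<tau>: "0 \<le> \<tau>" "\<tau> \<le> 1" by (auto simp: \<tau>_def)
  have P: "((\<lambda>t. t * (1 - t) powr s) has_integral inc_Beta d 2 (s + 1)) {0..d}"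
    if "0 \<le> d" "d \<le> 1" for d
    using has_integral_inc_Beta[of 2 "s + 1" d] s that by (force intro: has_integral_eq[rotated])
  have Q: "((\<lambda>t. t powr (\<alpha> + 1) * (1 - t) powr s) has_integral inc_Beta d (\<alpha> + 2) (s + 1)) {0..d}"
    if "0 \<le> d" "d \<le> 1" for d
    using has_integral_inc_Beta[of "\<alpha> + 2" "s + 1" d] s \<alpha> that by (simp add: add_ac)
  have int: "((\<lambda>t. \<bar>t * (c - t powr \<alpha>)\<bar> * (1 - t) powr s) has_integral
      2 * (c * inc_Beta \<tau> 2 (s + 1) - inc_Beta \<tau> (\<alpha> + 2) (s + 1))
      - (c * inc_Beta 1 2 (s + 1) - inc_Beta 1 (\<alpha> + 2) (s + 1))) {0..1}"
    by (rule has_integral_abs_kernel[OF \<alpha> c \<tau>_def P Q P Q]) (use \<tau> in auto)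
  have iff: "lam \<le> 1 / (\<alpha> + 1) \<longleftrightarrow> c \<le> 1"
    using \<alpha> by (simp add: c_def field_simps)
  have "2 * (c * inc_Beta \<tau> 2 (s + 1) - inc_Beta \<tau> (\<alpha> + 2) (s + 1))
      - (c * inc_Beta 1 2 (s + 1) - inc_Beta 1 (\<alpha> + 2) (s + 1)) = C3 \<alpha> lam s"
  proof (cases "c \<le> 1")
    case True
    have "\<tau> = ((\<alpha> + 1) * lam) powr (1 / \<alpha>)"
      using powr_mono2[of "1 / \<alpha>" c 1] True \<alpha> c by (simp add: \<tau>_def c_def)
    then show ?thesis
      using True iff \<alpha> s by (simp add: C3_def c_def inc_Beta_1 algebra_simps)
  next
    case False
    then have "\<tau> = 1"
      using ge_one_powr_ge_zero[of c "1 / \<alpha>"] \<alpha> by (simp add: \<tau>_def)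
    then show ?thesis
      using False iff \<alpha> s by (simp add: C3_def c_def inc_Beta_1)
  qed
  with int show ?thesis by (simp add: c_def)
qed

section \<open>The integral identity for one endpoint\<close>

text \<open>Both integrations by parts are packed into one antiderivative \<open>F\<close> made of
  the two boundary terms. The kernel has derivative
  \<open>(\<alpha> + 1) * (lam - t powr \<alpha>)\<close>, so the terms with \<open>f'\<close>
  cancel in the derivative of \<open>F\<close>, leaving the integrand with \<open>f''\<close> and a
  multiple of that of \<open>G\<close>. The sign of \<open>h\<close> is free, which serves both
  endpoints.\<close>

lemma has_integral_kernel_by_parts:
  fixes f f' f'' :: "real \<Rightarrow> real"
  assumes \<alpha>: "\<alpha> > 0" and h: "h \<noteq> 0"
    and f': "\<And>t. t \<in> {0..1} \<Longrightarrow> (f has_real_derivative f' (p + t * h)) (at (p + t * h))"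
    and f'': "\<And>t. t \<in> {0..1} \<Longrightarrow> (f' has_real_derivative f'' (p + t * h)) (at (p + t * h))"
    and G: "((\<lambda>t. t powr (\<alpha> - 1) * f (p + t * h)) has_integral G) {0..1}"
  shows "((\<lambda>t. t * ((\<alpha> + 1) * lam - t powr \<alpha>) * f'' (p + t * h)) has_integral
     (\<alpha> + 1) / h\<^sup>2 * ((1 - lam) * f (p + h) + lam * f p
       + (lam - 1 / (\<alpha> + 1)) * h * f' (p + h) - \<alpha> * G)) {0..1}"
proof -
  define F where "F t = t * ((\<alpha> + 1) * lam - t powr \<alpha>) * f' (p + t * h) / h
    - (\<alpha> + 1) * (lam - t powr \<alpha>) * f (p + t * h) / h\<^sup>2" for t
  have cf: "continuous_on {0..1} (\<lambda>t. f (p + t * h))"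
    by (rule continuous_at_imp_continuous_on)
       (auto intro!: isCont_o2[where g = f] DERIV_isCont[OF f'])
  have cf': "continuous_on {0..1} (\<lambda>t. f' (p + t * h))"
    by (rule continuous_at_imp_continuous_on)
       (auto intro!: isCont_o2[where g = f'] DERIV_isCont[OF f''])
  have "continuous_on {0..1} F"
    unfolding F_def
    by (intro continuous_intros continuous_on_powr' cf cf') (use \<alpha> h in auto)
  \<comment> \<open>Only interior points are taken: for \<open>\<alpha> < 1\<close> the power
    \<open>t powr \<alpha>\<close> is not differentiable at \<open>0\<close>. Continuity of
    \<open>F\<close> covers the ends.\<close>
  moreover have "(F has_vector_derivative (t * ((\<alpha> + 1) * lam - t powr \<alpha>) * f'' (p + t * h)
      + (\<alpha> + 1) * \<alpha> / h\<^sup>2 * (t powr (\<alpha> - 1) * f (p + t * h)))) (at t)" if t: "t \<in> {0<..<1}" for t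
  proof -
    have D: "((\<lambda>t. f (p + t * h)) has_real_derivative f' (p + t * h) * h) (at t)"
      "((\<lambda>t. f' (p + t * h)) has_real_derivative f'' (p + t * h) * h) (at t)"
      by (rule DERIV_chain2[where g = "\<lambda>t. p + t * h"], rule f' f'',
          use t in simp, auto intro!: derivative_eq_intros)+
    have tp: "t powr (\<alpha> - 1) = t powr \<alpha> / t"
      using t by (simp add: powr_diff)
    have pow: "((\<lambda>t. t powr \<alpha>) has_real_derivative \<alpha> * (t powr \<alpha> / t)) (at t)"
      using has_real_derivative_powr[of t \<alpha>] t by (simp add: tp)
    have k: "((\<lambda>t. t * ((\<alpha> + 1) * lam - t powr \<alpha>)) has_real_derivative
        (\<alpha> + 1) * (lam - t powr \<alpha>)) (at t)"
      by (rule derivative_eq_intros pow refl)+ (use t in \<open>simp add: algebra_simps\<close>)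
    have l: "((\<lambda>t. (\<alpha> + 1) * (lam - t powr \<alpha>)) has_real_derivative
        - ((\<alpha> + 1) * (\<alpha> * (t powr \<alpha> / t)))) (at t)"
      by (rule derivative_eq_intros pow refl)+ simp
    have "(F has_real_derivative
        ((\<alpha> + 1) * (lam - t powr \<alpha>) * f' (p + t * h)
          + f'' (p + t * h) * h * (t * ((\<alpha> + 1) * lam - t powr \<alpha>))) / h
        - (- ((\<alpha> + 1) * (\<alpha> * (t powr \<alpha> / t))) * f (p + t * h)
          + f' (p + t * h) * h * ((\<alpha> + 1) * (lam - t powr \<alpha>))) / h\<^sup>2) (at t)"
      unfolding F_def by (intro DERIV_diff DERIV_cdivide DERIV_mult k l D)
    also have "((\<alpha> + 1) * (lam - t powr \<alpha>) * f' (p + t * h)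
          + f'' (p + t * h) * h * (t * ((\<alpha> + 1) * lam - t powr \<alpha>))) / h
        - (- ((\<alpha> + 1) * (\<alpha> * (t powr \<alpha> / t))) * f (p + t * h)
          + f' (p + t * h) * h * ((\<alpha> + 1) * (lam - t powr \<alpha>))) / h\<^sup>2
      = t * ((\<alpha> + 1) * lam - t powr \<alpha>) * f'' (p + t * h)
        + (\<alpha> + 1) * \<alpha> / h\<^sup>2 * (t powr (\<alpha> - 1) * f (p + t * h))"
      using h by (simp add: tp add_divide_distrib diff_divide_distrib power2_eq_square mult_ac)
    finally show ?thesis
      by (simp only: has_real_derivative_iff_has_vector_derivative)
  qed
  ultimately have "((\<lambda>t. t * ((\<alpha> + 1) * lam - t powr \<alpha>) * f'' (p + t * h)
      + (\<alpha> + 1) * \<alpha> / h\<^sup>2 * (t powr (\<alpha> - 1) * f (p + t * h))) has_integral F 1 - F 0) {0..1}"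
    by (intro fundamental_theorem_of_calculus_interior) auto
  from has_integral_diff[OF this has_integral_mult_right[OF G, of "(\<alpha> + 1) * \<alpha> / h\<^sup>2"]]
  have "((\<lambda>t. t * ((\<alpha> + 1) * lam - t powr \<alpha>) * f'' (p + t * h)) has_integral
      F 1 - F 0 - (\<alpha> + 1) * \<alpha> / h\<^sup>2 * G) {0..1}"
    by simp
  \<comment> \<open>The \<open>f p\<close> term comes from \<open>F 0\<close>, where
    \<open>0 powr \<alpha> = 0\<close>; all others come from \<open>F 1\<close> and
    \<open>G\<close>.\<close>
  moreover have "F 1 - F 0 - (\<alpha> + 1) * \<alpha> / h\<^sup>2 * G = (\<alpha> + 1) / h\<^sup>2 * ((1 - lam) * f (p + h)
      + lam * f p + (lam - 1 / (\<alpha> + 1)) * h * f' (p + h) - \<alpha> * G)"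
    using \<alpha> h by (simp add: F_def divide_simps power2_eq_square) (simp add: algebra_simps)
  ultimately show ?thesis by simp
qed

lemma closed_segment_eq_image_affine:
  fixes p x :: real
  shows "closed_segment p x = (\<lambda>t. p + t * (x - p)) ` {0..1}"
  by (auto simp: closed_segment_image_interval algebra_simps)

text \<open>The substitution of \<open>p + t * (x - p)\<close> for the variable turns the fractional
  integral into the integral \<open>G\<close> of the identity. With absolute values and
  \<open>closed_segment\<close> one statement covers \<open>p < x\<close> and \<open>x < p\<close>.
  The Lebesgue integral is a genuine one since the kernel is absolutely integrable and
  \<open>f\<close> is bounded and measurable on the segment.\<close>

lemma has_integral_power_kernel:
  fixes p x :: real and f :: "real \<Rightarrow> real"
  assumes \<alpha>: "\<alpha> > 0" and px: "p \<noteq> x" and f: "continuous_on (closed_segment p x) f"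
  shows "((\<lambda>t. t powr (\<alpha> - 1) * f (p + t * (x - p))) has_integral
    (LINT t:closed_segment p x|lebesgue. \<bar>t - p\<bar> powr (\<alpha> - 1) * f t) / \<bar>x - p\<bar> powr \<alpha>) {0..1}"
proof -
  define h where "h = x - p"
  define S where "S = closed_segment p x"
  have h: "h \<noteq> 0" using px by (simp add: h_def)
  have S: "S = (\<lambda>t. p + t * h) ` {0..1}"
    unfolding S_def h_def by (rule closed_segment_eq_image_affine)
  have [simp]: "S \<in> sets lebesgue"
    by (simp add: S_def closed_segment_eq_real_ivl)
  have "((\<lambda>t. t powr (\<alpha> - 1)) has_integral 1 / \<alpha>) (cbox 0 (1::real))"
    using has_integral_powr_from_0[of "\<alpha> - 1" 1] \<alpha> by simp
  from has_integral_affinity[OF this, of "1 / h" "- (p / h)"]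
  have "((\<lambda>t. (t / h - p / h) powr (\<alpha> - 1)) has_integral \<bar>h\<bar> / \<alpha>) S"
    using h by (simp add: S mult.commute add.commute)
  from has_integral_mult_right[OF this, of "\<bar>h\<bar> powr (\<alpha> - 1)"]
  have "(\<lambda>t. \<bar>h\<bar> powr (\<alpha> - 1) * (t / h - p / h) powr (\<alpha> - 1)) integrable_on S"
    by blast
  \<comment> \<open>On \<open>S\<close> the quotient \<open>t / h - p / h\<close> is the parameter
    in \<open>{0..1}\<close>, hence nonnegative whatever the sign of \<open>h\<close>.\<close>
  moreover have "\<bar>h\<bar> powr (\<alpha> - 1) * (t / h - p / h) powr (\<alpha> - 1) = \<bar>t - p\<bar> powr (\<alpha> - 1)"
    if "t \<in> S" for t
  proof -
    from that obtain r where r: "r \<in> {0..1}" "t = p + r * h" by (auto simp: S)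
    then show ?thesis
      using h by (simp add: abs_mult add_divide_distrib powr_mult)
  qed
  ultimately have "(\<lambda>t. \<bar>t - p\<bar> powr (\<alpha> - 1)) integrable_on S"
    by (rule integrable_eq)
  then have k: "(\<lambda>t. \<bar>t - p\<bar> powr (\<alpha> - 1)) absolutely_integrable_on S"
    by (rule nonnegative_absolutely_integrable_1) simp
  have "(\<lambda>t. f t * \<bar>t - p\<bar> powr (\<alpha> - 1)) absolutely_integrable_on S"
  proof (rule absolutely_integrable_bounded_measurable_product_real)
    show "f \<in> borel_measurable (lebesgue_on S)"
      using f by (intro continuous_imp_measurable_on_sets_lebesgue) (auto simp: S_def[symmetric])
    show "bounded (f ` S)"
      using f by (auto simp: S_def intro!: compact_imp_bounded compact_continuous_image)
  qed (use k in auto)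
  then have "(\<lambda>t. \<bar>t - p\<bar> powr (\<alpha> - 1) * f t) absolutely_integrable_on S"
    by (simp add: mult.commute)
  note J = set_lebesgue_integral_eq_integral[OF this]
  define J where "J = (LINT t:S|lebesgue. \<bar>t - p\<bar> powr (\<alpha> - 1) * f t)"
  \<comment> \<open>The affine change of variables is stated for boxes, so the segment is written
    with its ends in increasing order.\<close>
  have "((\<lambda>t. \<bar>t - p\<bar> powr (\<alpha> - 1) * f t) has_integral J) (cbox (min p x) (max p x))"
    using J by (simp add: J_def has_integral_integral S_def closed_segment_eq_real_ivl min_def max_def
        split: if_splits)
  from has_integral_affinity[OF this h, of p]
  have "((\<lambda>t. \<bar>h * t\<bar> powr (\<alpha> - 1) * f (h * t + p)) has_integral J / \<bar>h\<bar>)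
      ((\<lambda>t. t / h - p / h) ` cbox (min p x) (max p x))"
    by simp
  also have "(cbox (min p x) (max p x)) = S"
    by (auto simp: S_def closed_segment_eq_real_ivl)
  also have "(\<lambda>t. t / h - p / h) ` S = {0..1}"
    using h by (simp add: S image_image add_divide_distrib)
  finally have "((\<lambda>t. \<bar>h * t\<bar> powr (\<alpha> - 1) * f (h * t + p)) has_integral J / \<bar>h\<bar>) {0..1}" .
  \<comment> \<open>This factor cancels the power of \<open>h\<close> in the kernel; with the
    Jacobian \<open>1 / \<bar>h\<bar>\<close> it yields the denominator
    \<open>\<bar>h\<bar> powr \<alpha>\<close>.\<close>
  from has_integral_mult_right[OF this, of "\<bar>h\<bar> powr (1 - \<alpha>)"]
  have "((\<lambda>t. \<bar>h\<bar> powr (1 - \<alpha>) * (\<bar>h * t\<bar> powr (\<alpha> - 1) * f (h * t + p))) has_integral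
      \<bar>h\<bar> powr (1 - \<alpha>) * (J / \<bar>h\<bar>)) {0..1}" .
  also have "\<bar>h\<bar> powr (1 - \<alpha>) * (J / \<bar>h\<bar>) = J / \<bar>h\<bar> powr \<alpha>"
    using h by (simp add: powr_diff)
  finally have *: "((\<lambda>t. \<bar>h\<bar> powr (1 - \<alpha>) * (\<bar>h * t\<bar> powr (\<alpha> - 1) * f (h * t + p))) has_integral
      J / \<bar>h\<bar> powr \<alpha>) {0..1}" .
  have "\<bar>h\<bar> powr (1 - \<alpha>) * (\<bar>h * t\<bar> powr (\<alpha> - 1) * f (h * t + p))
      = t powr (\<alpha> - 1) * f (p + t * h)" if "t \<in> {0..1}" for t
    using h that by (simp add: abs_mult powr_mult powr_diff algebra_simps)
  then have "((\<lambda>t. t powr (\<alpha> - 1) * f (p + t * h)) has_integral J / \<bar>h\<bar> powr \<alpha>) {0..1}"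
    using * by (rule has_integral_eq)
  then show ?thesis by (simp add: J_def h_def S_def)
qed

section \<open>The bound for one endpoint and the assembly\<close>

text \<open>The power mean bound applied to the by-parts identity, with the absolute kernel as
  weight and the s-convexity estimate times this weight as majorant. Multiplying by
  \<open>\<bar>x - p\<bar> powr (\<alpha> + 2) / (\<alpha> + 1)\<close> then clears the coefficients
  of the identity.\<close>

lemma one_sided_bound:
  fixes f f' f'' :: "real \<Rightarrow> real"
  assumes \<alpha>: "\<alpha> > 0" and lam: "lam \<ge> 0" and s: "s \<ge> 0" and q: "q \<ge> 1"
    and f': "\<And>t. t \<in> closed_segment p x \<Longrightarrow> (f has_real_derivative f' t) (at t)"
    and f'': "\<And>t. t \<in> closed_segment p x \<Longrightarrow> (f' has_real_derivative f'' t) (at t)"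
    and conv: "\<And>t. t \<in> {0..1} \<Longrightarrow> \<bar>f'' (p + t * (x - p))\<bar> powr q
      \<le> t powr s * \<bar>f'' x\<bar> powr q + (1 - t) powr s * \<bar>f'' p\<bar> powr q"
  shows "\<bar>\<bar>x - p\<bar> powr \<alpha> * ((1 - lam) * f x + lam * f p + (lam - 1 / (\<alpha> + 1)) * (x - p) * f' x)
      - \<alpha> * (LINT t:closed_segment p x|lebesgue. \<bar>t - p\<bar> powr (\<alpha> - 1) * f t)\<bar>
    \<le> \<bar>x - p\<bar> powr (\<alpha> + 2) / (\<alpha> + 1) * (C1 \<alpha> lam powr (1 - 1 / q)
      * (\<bar>f'' x\<bar> powr q * C2 \<alpha> lam s + \<bar>f'' p\<bar> powr q * C3 \<alpha> lam s) powr (1 / q))"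
proof (cases "p = x")
  case True
  \<comment> \<open>In the degenerate case both sides vanish, since \<open>0 powr r = 0\<close> for
    every \<open>r\<close>, including negative ones.\<close>
  have "indicator {x} t *\<^sub>R (\<bar>t - x\<bar> powr (\<alpha> - 1) * f t) = 0" for t
    by (cases "t = x") auto
  then have "(LINT t:{x}|lebesgue. \<bar>t - x\<bar> powr (\<alpha> - 1) * f t) = 0"
    by (simp only: set_lebesgue_integral_def integral_zero)
  then show ?thesis using True by simp
next
  case False
  define h where "h = x - p"
  define J where "J = (LINT t:closed_segment p x|lebesgue. \<bar>t - p\<bar> powr (\<alpha> - 1) * f t)"
  define k where "k t = \<bar>t * ((\<alpha> + 1) * lam - t powr \<alpha>)\<bar>" for t
  define A D where "A = \<bar>f'' x\<bar> powr q" and "D = \<bar>f'' p\<bar> powr q"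
  define E where "E = (1 - lam) * f x + lam * f p + (lam - 1 / (\<alpha> + 1)) * h * f' x"
  have h: "h \<noteq> 0" using False by (simp add: h_def)
  have mem: "p + t * h \<in> closed_segment p x" if "t \<in> {0..1}" for t
    unfolding closed_segment_eq_image_affine h_def using that by blast
  have "continuous_on (closed_segment p x) f"
    using f' by (intro continuous_at_imp_continuous_on) (auto intro: DERIV_isCont)
  from has_integral_power_kernel[OF \<alpha> False this]
  have G: "((\<lambda>t. t powr (\<alpha> - 1) * f (p + t * h)) has_integral J / \<bar>h\<bar> powr \<alpha>) {0..1}"
    by (simp add: J_def h_def)
  have u: "((\<lambda>t. t * ((\<alpha> + 1) * lam - t powr \<alpha>) * f'' (p + t * h)) has_integral
      (\<alpha> + 1) / h\<^sup>2 * (E - \<alpha> * (J / \<bar>h\<bar> powr \<alpha>))) {0..1}"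
    using has_integral_kernel_by_parts[OF \<alpha> h f'[OF mem] f''[OF mem] G]
    by (simp add: E_def h_def)
  have "\<bar>(\<alpha> + 1) / h\<^sup>2 * (E - \<alpha> * (J / \<bar>h\<bar> powr \<alpha>))\<bar>
      \<le> C1 \<alpha> lam powr (1 - 1 / q) * (A * C2 \<alpha> lam s + D * C3 \<alpha> lam s) powr (1 / q)"
    (is "_ \<le> ?M")
  proof (rule has_integral_power_mean_bound[OF q C1_pos[OF \<alpha> lam] _ _ u])
    show "(k has_integral C1 \<alpha> lam) {0..1}"
      unfolding k_def by (rule has_integral_C1[OF \<alpha> lam])
    show "((\<lambda>t. A * (k t * t powr s) + D * (k t * (1 - t) powr s)) has_integral
        A * C2 \<alpha> lam s + D * C3 \<alpha> lam s) {0..1}"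
      unfolding k_def
      by (intro has_integral_add has_integral_mult_right has_integral_C2 has_integral_C3 \<alpha> lam s)
    show "k t * \<bar>f'' (p + t * h)\<bar> powr q \<le> A * (k t * t powr s) + D * (k t * (1 - t) powr s)"
      if "t \<in> {0..1}" for t
    proof -
      have "k t * \<bar>f'' (p + t * h)\<bar> powr q \<le> k t * (t powr s * A + (1 - t) powr s * D)"
        using conv[OF that] by (intro mult_left_mono) (auto simp: k_def A_def D_def h_def)
      then show ?thesis by (simp add: algebra_simps)
    qed
  qed (auto simp: k_def abs_mult)
  then have "\<bar>h\<bar> powr \<alpha> * h\<^sup>2 / (\<alpha> + 1) * \<bar>(\<alpha> + 1) / h\<^sup>2 * (E - \<alpha> * (J / \<bar>h\<bar> powr \<alpha>))\<bar>
      \<le> \<bar>h\<bar> powr \<alpha> * h\<^sup>2 / (\<alpha> + 1) * ?M"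
    using \<alpha> by (intro mult_left_mono) auto
  also have "\<bar>h\<bar> powr \<alpha> * h\<^sup>2 / (\<alpha> + 1) * \<bar>(\<alpha> + 1) / h\<^sup>2 * (E - \<alpha> * (J / \<bar>h\<bar> powr \<alpha>))\<bar>
      = \<bar>\<bar>h\<bar> powr \<alpha> * h\<^sup>2 / (\<alpha> + 1) * ((\<alpha> + 1) / h\<^sup>2 * (E - \<alpha> * (J / \<bar>h\<bar> powr \<alpha>)))\<bar>"
    using \<alpha> by (simp add: abs_mult)
  also have "\<bar>h\<bar> powr \<alpha> * h\<^sup>2 / (\<alpha> + 1) * ((\<alpha> + 1) / h\<^sup>2 * (E - \<alpha> * (J / \<bar>h\<bar> powr \<alpha>)))
      = \<bar>h\<bar> powr \<alpha> * (E - \<alpha> * (J / \<bar>h\<bar> powr \<alpha>))"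
    using \<alpha> h by simp
  also have "\<dots> = \<bar>h\<bar> powr \<alpha> * E - \<alpha> * J"
    using h by (simp add: right_diff_distrib)
  also have "\<bar>h\<bar> powr \<alpha> * h\<^sup>2 = \<bar>h\<bar> powr (\<alpha> + 2)"
    using h by (simp add: powr_add)
  finally show ?thesis
    by (simp add: E_def J_def h_def A_def D_def)
qed

lemma s_convex_on_closed_segment:
  assumes g: "s_convex_on s {a..b} g" and "p \<in> {a..b}" "x \<in> {a..b}" "t \<in> {0..1}"
  shows "g (p + t * (x - p)) \<le> t powr s * g x + (1 - t) powr s * g p"
proof -
  have "g (t * x + (1 - t) * p) \<le> t powr s * g x + (1 - t) powr s * g p"
    using assms unfolding s_convex_on_def by auto
  then show ?thesis by (simp add: algebra_simps)
qed

theorem theorem6: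
  fixes I :: "real set" and f :: "real \<Rightarrow> real" and a b s q :: real
  assumes "is_interval I" and "I \<subseteq> {0..}"
    and "f differentiable_on interior I"
    and "deriv f differentiable_on interior I"
    and "a \<in> interior I" and "b \<in> interior I" and "a < b"
    and "deriv (deriv f) absolutely_integrable_on {a..b}"
    and "0 < s" and "s \<le> 1" and "q \<ge> 1"
    and "s_convex_on s {a..b} (\<lambda>t. \<bar>deriv (deriv f) t\<bar> powr q)"
  shows "\<forall>x\<in>{a..b}. \<forall>lam\<in>{0..1}. \<forall>\<alpha>>0.
    \<bar>I_frac f x lam \<alpha> a b\<bar> \<le>
      C1 \<alpha> lam powr (1 - 1 / q) *
      ((x - a) powr (\<alpha> + 2) / ((\<alpha> + 1) * (b - a)) *
         (\<bar>deriv (deriv f) x\<bar> powr q * C2 \<alpha> lam s + \<bar>deriv (deriv f) a\<bar> powr q * C3 \<alpha> lam s) powr (1 / q)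
       + (b - x) powr (\<alpha> + 2) / ((\<alpha> + 1) * (b - a)) *
         (\<bar>deriv (deriv f) x\<bar> powr q * C2 \<alpha> lam s + \<bar>deriv (deriv f) b\<bar> powr q * C3 \<alpha> lam s) powr (1 / q))"
proof (intro ballI allI impI)
  fix x lam \<alpha> :: real
  assume x: "x \<in> {a..b}" and lam: "lam \<in> {0..1}" and \<alpha>: "\<alpha> > 0"
  have "convex (interior I)"
    using assms(1) by (intro convex_interior is_interval_convex)
  then have "closed_segment a b \<subseteq> interior I"
    using assms(5,6) by (rule closed_segment_subset[rotated 2])
  then have sub: "{a..b} \<subseteq> interior I"
    using assms(7) by (simp add: closed_segment_eq_real_ivl)
  have D: "(g has_real_derivative deriv g t) (at t)"
    if "g differentiable_on interior I" "t \<in> {a..b}" for g :: "real \<Rightarrow> real" and t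
  proof -
    have "g differentiable (at t)"
      using that sub by (auto simp: differentiable_on_eq_differentiable_at)
    then show ?thesis
      by (simp add: real_differentiable_def DERIV_deriv_iff_real_differentiable)
  qed
  \<comment> \<open>The contribution of the endpoint \<open>p\<close> to
    \<open>(b - a) * I_frac f x lam \<alpha> a b\<close>. For \<open>p = b\<close> the negative
    factor \<open>x - p\<close> produces the opposite sign of the \<open>deriv f x\<close>
    term.\<close>
  define T where "T p = \<bar>x - p\<bar> powr \<alpha> * ((1 - lam) * f x + lam * f p
      + (lam - 1 / (\<alpha> + 1)) * (x - p) * deriv f x)
      - \<alpha> * (LINT t:closed_segment p x|lebesgue. \<bar>t - p\<bar> powr (\<alpha> - 1) * f t)" for p
  define M where "M p = (\<bar>deriv (deriv f) x\<bar> powr q * C2 \<alpha> lam s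
      + \<bar>deriv (deriv f) p\<bar> powr q * C3 \<alpha> lam s) powr (1 / q)" for p
  have bound: "\<bar>T p\<bar> \<le> \<bar>x - p\<bar> powr (\<alpha> + 2) / (\<alpha> + 1) * (C1 \<alpha> lam powr (1 - 1 / q) * M p)"
    if p: "p \<in> {a..b}" for p
    unfolding T_def M_def
  proof (rule one_sided_bound)
    have seg: "closed_segment p x \<subseteq> {a..b}"
      using p x by (intro closed_segment_subset) auto
    show "(f has_real_derivative deriv f t) (at t)" if "t \<in> closed_segment p x" for t
      using D assms(3) seg that by blast
    show "(deriv f has_real_derivative deriv (deriv f) t) (at t)" if "t \<in> closed_segment p x" for t
      using D assms(4) seg that by blast
    show "\<bar>deriv (deriv f) (p + t * (x - p))\<bar> powr q \<le> t powr s * \<bar>deriv (deriv f) x\<bar> powr q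
        + (1 - t) powr s * \<bar>deriv (deriv f) p\<bar> powr q" if "t \<in> {0..1}" for t
      by (rule s_convex_on_closed_segment[OF assms(12) p x that])
  qed (use \<alpha> lam assms in auto)
  \<comment> \<open>The functional equation of Gamma absorbs the normalization of the fractional
    integrals.\<close>
  have Gam: "Gamma (\<alpha> + 1) * (1 / Gamma \<alpha> * y) = \<alpha> * y" for y
    using \<alpha> less_imp_neq[OF Gamma_real_pos[OF \<alpha>]] by (simp add: Gamma_plus1 nonpos_Ints_def)
  have RLm: "Gamma (\<alpha> + 1) * RL_minus \<alpha> x f a
      = \<alpha> * (LINT t:closed_segment a x|lebesgue. \<bar>t - a\<bar> powr (\<alpha> - 1) * f t)"
    unfolding RL_minus_def Gam using x
    by (auto simp: closed_segment_eq_real_ivl intro!: set_lebesgue_integral_cong)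
  have RLp: "Gamma (\<alpha> + 1) * RL_plus \<alpha> x f b
      = \<alpha> * (LINT t:closed_segment b x|lebesgue. \<bar>t - b\<bar> powr (\<alpha> - 1) * f t)"
    unfolding RL_plus_def Gam using x
    by (auto simp: closed_segment_eq_real_ivl abs_minus_commute intro!: set_lebesgue_integral_cong)
  have pow: "y powr (\<alpha> + 1) = y powr \<alpha> * y" if "y \<ge> 0" for y
    using that by (cases "y = 0") (auto simp: powr_add)
  have "I_frac f x lam \<alpha> a b = ((1 - lam) * ((x - a) powr \<alpha> + (b - x) powr \<alpha>) * f x
      + lam * ((x - a) powr \<alpha> * f a + (b - x) powr \<alpha> * f b)
      + (1 / (\<alpha> + 1) - lam) * ((b - x) powr (\<alpha> + 1) - (x - a) powr (\<alpha> + 1)) * deriv f x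
      - (Gamma (\<alpha> + 1) * RL_minus \<alpha> x f a + Gamma (\<alpha> + 1) * RL_plus \<alpha> x f b)) / (b - a)"
    by (simp add: I_frac_def add_divide_distrib diff_divide_distrib algebra_simps)
  also have "\<dots> = (T a + T b) / (b - a)"
  proof -
    have abs: "\<bar>x - a\<bar> = x - a" "\<bar>x - b\<bar> = b - x"
      using x by auto
    have pow_ab: "(x - a) powr (\<alpha> + 1) = (x - a) powr \<alpha> * (x - a)"
      "(b - x) powr (\<alpha> + 1) = (b - x) powr \<alpha> * (b - x)"
      using x by (auto intro: pow)
    show ?thesis
      unfolding T_def RLm RLp abs pow_ab by (rule arg_cong[where f = "\<lambda>z. z / (b - a)"]) algebra
  qed
  finally have "\<bar>I_frac f x lam \<alpha> a b\<bar> = \<bar>T a + T b\<bar> / (b - a)"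
    using assms(7) by simp
  also have "\<dots> \<le> (\<bar>x - a\<bar> powr (\<alpha> + 2) / (\<alpha> + 1) * (C1 \<alpha> lam powr (1 - 1 / q) * M a)
      + \<bar>x - b\<bar> powr (\<alpha> + 2) / (\<alpha> + 1) * (C1 \<alpha> lam powr (1 - 1 / q) * M b)) / (b - a)"
    using bound[of a] bound[of b] assms(7) by (intro divide_right_mono) auto
  also have "\<dots> = C1 \<alpha> lam powr (1 - 1 / q) * ((x - a) powr (\<alpha> + 2) / ((\<alpha> + 1) * (b - a)) * M a
      + (b - x) powr (\<alpha> + 2) / ((\<alpha> + 1) * (b - a)) * M b)"
    using x by (simp add: add_divide_distrib distrib_left mult_ac)
  finally show "\<bar>I_frac f x lam \<alpha> a b\<bar> \<le>
      C1 \<alpha> lam powr (1 - 1 / q) *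
      ((x - a) powr (\<alpha> + 2) / ((\<alpha> + 1) * (b - a)) *
         (\<bar>deriv (deriv f) x\<bar> powr q * C2 \<alpha> lam s + \<bar>deriv (deriv f) a\<bar> powr q * C3 \<alpha> lam s) powr (1 / q)
       + (b - x) powr (\<alpha> + 2) / ((\<alpha> + 1) * (b - a)) *
         (\<bar>deriv (deriv f) x\<bar> powr q * C2 \<alpha> lam s + \<bar>deriv (deriv f) b\<bar> powr q * C3 \<alpha> lam s) powr (1 / q))"
    unfolding M_def .
qed

end
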